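(* For every real number $c<4$ there exists an integer $n_0$ such that $\text{sat}^*(n, \mathcal D_2)\geq c\sqrt n$ for every $n\geq n_0$.
   Context: All families considered are families of subsets of $[n]=\{1,\dots,n\}$, partially ordered by inclusion. The diamond poset $\mathcal D_2$ is the 4-element poset with one minimal element, one maximal element and two incomparable middle elements (the two-dimensional Boolean lattice). A family $\mathcal F$ contains an induced copy of $\mathcal D_2$ if there are four distinct sets $W,X,Y,Z\in\mathcal F$ with $W\subset X\subset Z$, $W\subset Y\subset Z$ and $X,Y$ incomparable under inclusion. A family $\mathcal F$ of subsets of $[n]$ is $\mathcal D_2$-saturated if it contains no induced copy of $\mathcal D_2$, but for every subset $S\subseteq[n]$ with $S\notin\mathcal F$, the family $\mathcal F\cup\{S\}$ contains an induced copy of $\mathcal D_2$. $\text{sat}^*(n,\mathcal D_2)$ denotes the minimum size of a $\mathcal D_2$-saturated family of subsets of $[n]$. *)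

theory Defs
  imports Complex_Main
begin

definition has_induced_diamond :: "nat set set \<Rightarrow> bool" where
  "has_induced_diamond F \<longleftrightarrow>
     (\<exists>W\<in>F. \<exists>X\<in>F. \<exists>Y\<in>F. \<exists>Z\<in>F. distinct [W, X, Y, Z] \<and>
        W \<subset> X \<and> X \<subset> Z \<and> W \<subset> Y \<and> Y \<subset> Z \<and> \<not> X \<subseteq> Y \<and> \<not> Y \<subseteq> X)"

definition diamond_saturated :: "nat \<Rightarrow> nat set set \<Rightarrow> bool" where
  "diamond_saturated n F \<longleftrightarrow>
     F \<subseteq> Pow {1..n} \<and> \<not> has_induced_diamond F \<and>
     (\<forall>S. S \<subseteq> {1..n} \<and> S \<notin> F \<longrightarrow> has_induced_diamond (insert S F))"

definition sat_star_diamond :: "nat \<Rightarrow> nat" where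
  "sat_star_diamond n = Min {card F | F. diamond_saturated n F}"

text \<open>The minimum is taken over a finite nonempty set.\<close>

lemma finite_card_diamond_saturated: "finite {card F | F. diamond_saturated n F}"
proof (rule finite_subset)
  show "{card F | F. diamond_saturated n F} \<subseteq> card ` Pow (Pow {1..n})"
    by (auto simp: diamond_saturated_def)
qed simp

lemma diamond_saturated_exists: "\<exists>F. diamond_saturated n F"
proof -
  define A where "A = {F. F \<subseteq> Pow {1..n} \<and> \<not> has_induced_diamond F}"
  have fin: "finite A"
    unfolding A_def by (rule finite_subset[of _ "Pow (Pow {1..n})"]) auto
  have "{} \<in> A"
    by (simp add: A_def has_induced_diamond_def)
  then have "A \<noteq> {}" by blast
  from finite_has_maximal[OF fin this] obtain F
    where F: "F \<in> A" and max: "\<forall>G\<in>A. F \<subseteq> G \<longrightarrow> F = G" by (elim bexE)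
  have "has_induced_diamond (insert S F)" if S: "S \<subseteq> {1..n}" "S \<notin> F" for S
  proof (rule ccontr)
    assume "\<not> has_induced_diamond (insert S F)"
    then have "insert S F \<in> A" using F S(1) by (simp add: A_def)
    with max have "F = insert S F" by (simp add: subset_insertI)
    with S(2) show False by (metis insertI1)
  qed
  with F have "diamond_saturated n F"
    by (simp add: A_def diamond_saturated_def)
  then show ?thesis ..
qed

lemma card_diamond_saturated_nonempty: "{card F | F. diamond_saturated n F} \<noteq> {}"
  using diamond_saturated_exists by auto

end

theory Submission
  imports Defs
begin

text \<open>
  Let \<open>F\<close> be saturated. Removing a point from a minimal member of \<open>F\<close> yields a set that can only
  be the bottom of a new diamond; this forces \<open>card W \<le> card F\<close> for each minimal member \<open>W\<close>.
  If \<open>M\<close> is a maximal set that is the bottom of a diamond whose other members lie in \<open>F\<close>, then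
  each point \<open>i\<close> outside \<open>M\<close> is the only point outside \<open>M\<close> of some minimal member. So \<open>M\<close> misses at
  most \<open>card F\<close> points, and every \<open>i\<close> lying in some minimal member satisfies \<open>W - X = {i}\<close> for a
  minimal \<open>W\<close> and a non-maximal \<open>X\<close> missing at most \<open>card F\<close> points. At most \<open>card F\<close> points lie in
  no minimal member, since the part of \<open>F\<close> above a fixed minimal member is a tree in which every
  such point is added on its own at some step. Hence \<open>n \<le> card F + a * l\<close>, where \<open>a\<close> and \<open>l\<close> are the
  numbers of minimal and of large non-maximal members. Dually \<open>n \<le> card F + b * m\<close> for the maximal
  and the small non-minimal members. These four classes are disjoint when \<open>2 * card F < n\<close>, so AM-GM
  gives \<open>16 * n \<le> (card F)\<^sup>2 + 16 * card F\<close>; and otherwise \<open>16 * n \<le> 32 * card F\<close>. In both cases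
  \<open>16 * n \<le> (card F + 8)\<^sup>2\<close>.
\<close>

section \<open>Extremal members and diamonds\<close>

definition minimal_members :: "'a set set \<Rightarrow> 'a set set" where
  "minimal_members F = {W \<in> F. \<forall>V\<in>F. V \<subseteq> W \<longrightarrow> V = W}"

definition maximal_members :: "'a set set \<Rightarrow> 'a set set" where
  "maximal_members F = {Z \<in> F. \<forall>V\<in>F. Z \<subseteq> V \<longrightarrow> V = Z}"

lemma minimal_members_subset: "minimal_members F \<subseteq> F"
  and maximal_members_subset: "maximal_members F \<subseteq> F"
  by (simp_all add: minimal_members_def maximal_members_def)

lemma ex_minimal_member_below:
  assumes "finite F" "S \<in> F"
  shows "\<exists>W\<in>minimal_members F. W \<subseteq> S"
proof -
  obtain W where "W \<in> F" "W \<subseteq> S" "\<forall>V\<in>F. V \<subseteq> W \<longrightarrow> W = V"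
    using finite_has_minimal2[OF assms] by (elim bexE conjE)
  then show ?thesis by (intro bexI[of _ W]) (auto simp: minimal_members_def)
qed

lemma ex_maximal_member_above:
  assumes "finite F" "S \<in> F"
  shows "\<exists>Z\<in>maximal_members F. S \<subseteq> Z"
proof -
  obtain Z where "Z \<in> F" "S \<subseteq> Z" "\<forall>V\<in>F. Z \<subseteq> V \<longrightarrow> Z = V"
    using finite_has_maximal2[OF assms] by (elim bexE conjE)
  then show ?thesis by (intro bexI[of _ Z]) (auto simp: maximal_members_def)
qed

definition small_nonminimal_members :: "'a set set \<Rightarrow> 'a set set" where
  "small_nonminimal_members F = {S \<in> F - minimal_members F. card S \<le> card F}"

definition large_nonmaximal_members :: "'a set \<Rightarrow> 'a set set \<Rightarrow> 'a set set" where
  "large_nonmaximal_members E F = {S \<in> F - maximal_members F. card (E - S) \<le> card F}"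

definition diamond_bottoms :: "'a set set \<Rightarrow> 'a set set" where
  "diamond_bottoms F =
     {S. \<exists>X\<in>F. \<exists>Y\<in>F. \<exists>Z\<in>F. S \<subseteq> X \<and> S \<subseteq> Y \<and> X \<subseteq> Z \<and> Y \<subseteq> Z \<and> \<not> X \<subseteq> Y \<and> \<not> Y \<subseteq> X}"

definition diamond_free :: "'a set set \<Rightarrow> bool" where
  "diamond_free F \<longleftrightarrow> F \<inter> diamond_bottoms F = {}"

lemma diamond_bottoms_downward_closed:
  "S \<in> diamond_bottoms F \<Longrightarrow> T \<subseteq> S \<Longrightarrow> T \<in> diamond_bottoms F"
  unfolding diamond_bottoms_def mem_Collect_eq by (meson subset_trans)

lemma diamond_free_iff_interval_chain:
  "diamond_free F \<longleftrightarrow>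
     (\<forall>V\<in>F. \<forall>X\<in>F. \<forall>Y\<in>F. \<forall>Z\<in>F. V \<subseteq> X \<and> V \<subseteq> Y \<and> X \<subseteq> Z \<and> Y \<subseteq> Z \<longrightarrow> X \<subseteq> Y \<or> Y \<subseteq> X)"
  unfolding diamond_free_def diamond_bottoms_def disjoint_iff mem_Collect_eq by meson

lemma not_diamond_freeE:
  assumes "\<not> diamond_free F"
  obtains V X Y Z where "V \<in> F" "X \<in> F" "Y \<in> F" "Z \<in> F"
    "V \<subseteq> X" "V \<subseteq> Y" "X \<subseteq> Z" "Y \<subseteq> Z" "\<not> X \<subseteq> Y" "\<not> Y \<subseteq> X"
  using assms unfolding diamond_free_iff_interval_chain by blast

lemma has_induced_diamond_iff_not_diamond_free: "has_induced_diamond F \<longleftrightarrow> \<not> diamond_free F"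
proof
  assume "has_induced_diamond F"
  then show "\<not> diamond_free F"
    unfolding has_induced_diamond_def diamond_free_iff_interval_chain by (meson psubset_imp_subset)
next
  assume "\<not> diamond_free F"
  then obtain V X Y Z where VXYZ: "V \<in> F" "X \<in> F" "Y \<in> F" "Z \<in> F"
    "V \<subseteq> X" "V \<subseteq> Y" "X \<subseteq> Z" "Y \<subseteq> Z" "\<not> X \<subseteq> Y" "\<not> Y \<subseteq> X"
    by (rule not_diamond_freeE)
  then have "V \<subset> X" "V \<subset> Y" "X \<subset> Z" "Y \<subset> Z" "distinct [V, X, Y, Z]" by auto
  with VXYZ show "has_induced_diamond F" unfolding has_induced_diamond_def by blast
qed

lemma obtain_nonmaximal_member_avoiding:
  assumes "S \<in> diamond_bottoms F" "insert i S \<notin> diamond_bottoms F"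
  obtains X where "X \<in> F - maximal_members F" "S \<subseteq> X" "i \<notin> X"
proof -
  obtain X Y Z where XYZ: "X \<in> F" "Y \<in> F" "Z \<in> F" "S \<subseteq> X" "S \<subseteq> Y" "X \<subseteq> Z" "Y \<subseteq> Z"
    "\<not> X \<subseteq> Y" "\<not> Y \<subseteq> X"
    using assms(1) unfolding diamond_bottoms_def by blast
  then have nonmaximal: "X \<notin> maximal_members F" "Y \<notin> maximal_members F"
    unfolding maximal_members_def by blast+
  have "i \<notin> X \<or> i \<notin> Y"
  proof (rule ccontr)
    assume "\<not> (i \<notin> X \<or> i \<notin> Y)"
    then have "insert i S \<subseteq> X" "insert i S \<subseteq> Y" using XYZ by auto
    then have "insert i S \<in> diamond_bottoms F" using XYZ unfolding diamond_bottoms_def by blast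
    with assms(2) show False ..
  qed
  then show thesis using that[of X] that[of Y] XYZ nonmaximal by auto
qed

section \<open>Complementation\<close>

lemma image_complement_complement: "F \<subseteq> Pow E \<Longrightarrow> (-) E ` (-) E ` F = F"
  by (force simp: image_image double_diff)

lemma inj_on_complement_Pow: "inj_on ((-) E) (Pow E)"
  by (rule inj_onI) blast

lemma card_image_complement: "F \<subseteq> Pow E \<Longrightarrow> card ((-) E ` F) = card F"
  by (rule card_image) (rule inj_on_subset[OF inj_on_complement_Pow])

lemma diamond_free_complement:
  assumes "F \<subseteq> Pow E"
  shows "diamond_free ((-) E ` F) \<longleftrightarrow> diamond_free F"
proof -
  have "E - A \<subseteq> E - B \<longleftrightarrow> B \<subseteq> A" if "A \<in> F" "B \<in> F" for A B
    using that assms by blast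
  then show ?thesis
    unfolding diamond_free_iff_interval_chain by (simp cong: ball_cong) blast
qed

lemma minimal_members_complement:
  assumes "F \<subseteq> Pow E"
  shows "minimal_members ((-) E ` F) = (-) E ` maximal_members F"
proof -
  have "E - A \<subseteq> E - B \<longleftrightarrow> B \<subseteq> A" "E - A = E - B \<longleftrightarrow> A = B" if "A \<in> F" "B \<in> F" for A B
    using that assms by blast+
  then show ?thesis
    unfolding minimal_members_def maximal_members_def Compr_image_eq
    by (simp cong: conj_cong ball_cong)
qed

lemma maximal_members_complement:
  assumes "F \<subseteq> Pow E"
  shows "maximal_members ((-) E ` F) = (-) E ` minimal_members F"
proof -
  have "(-) E ` F \<subseteq> Pow E" by blast
  from minimal_members_complement[OF this] have
    "minimal_members F = (-) E ` maximal_members ((-) E ` F)"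
    by (simp add: image_complement_complement[OF assms])
  moreover have "maximal_members ((-) E ` F) \<subseteq> Pow E"
    using maximal_members_subset by blast
  ultimately show ?thesis by (simp add: image_complement_complement)
qed

lemma large_nonmaximal_members_complement:
  assumes "F \<subseteq> Pow E"
  shows "large_nonmaximal_members E ((-) E ` F) = (-) E ` small_nonminimal_members F"
proof -
  have "(-) E ` F - (-) E ` minimal_members F = (-) E ` (F - minimal_members F)"
    using assms minimal_members_subset
    by (intro inj_on_image_set_diff[OF inj_on_complement_Pow, symmetric]) blast+
  moreover have "E - (E - S) = S" if "S \<in> F" for S
    using assms that by blast
  ultimately show ?thesis
    unfolding large_nonmaximal_members_def small_nonminimal_members_def
      maximal_members_complement[OF assms] card_image_complement[OF assms]
    by (simp add: Compr_image_eq cong: conj_cong)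
qed

section \<open>Saturated families\<close>

locale diamond_saturated_family =
  fixes E :: "'a set" and F :: "'a set set"
  assumes finite_ground: "finite E"
    and members_subset: "F \<subseteq> Pow E"
    and diamond_free: "diamond_free F"
    and saturated: "S \<subseteq> E \<Longrightarrow> S \<notin> F \<Longrightarrow> \<not> diamond_free (insert S F)"
begin

lemma finite_members: "finite F"
  using members_subset finite_ground by (simp add: finite_subset)

lemma interval_chain:
  assumes "V \<in> F" "X \<in> F" "Y \<in> F" "Z \<in> F" "V \<subseteq> X" "V \<subseteq> Y" "X \<subseteq> Z" "Y \<subseteq> Z"
  shows "X \<subseteq> Y \<or> Y \<subseteq> X"
  using diamond_free assms unfolding diamond_free_iff_interval_chain by blast

lemma member_not_subset_diamond_bottom: "S \<in> F \<Longrightarrow> B \<in> diamond_bottoms F \<Longrightarrow> \<not> S \<subseteq> B"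
  using diamond_free diamond_bottoms_downward_closed unfolding diamond_free_def by blast

lemma diamond_bottoms_subset: "diamond_bottoms F \<subseteq> Pow E"
  using members_subset unfolding diamond_bottoms_def by blast

lemma complement_saturated: "diamond_saturated_family E ((-) E ` F)"
proof
  show "finite E" by (rule finite_ground)
  show "(-) E ` F \<subseteq> Pow E" by blast
  show "diamond_free ((-) E ` F)"
    using diamond_free diamond_free_complement[OF members_subset] by simp
  fix S assume S: "S \<subseteq> E" "S \<notin> (-) E ` F"
  then have "E - S \<notin> F" using double_diff[OF S(1) subset_refl] by blast
  then have "\<not> diamond_free (insert (E - S) F)" by (intro saturated) auto
  moreover have "insert (E - S) F \<subseteq> Pow E" using members_subset by blast
  ultimately have "\<not> diamond_free ((-) E ` insert (E - S) F)"
    using diamond_free_complement by blast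
  then show "\<not> diamond_free (insert S ((-) E ` F))"
    using double_diff[OF S(1) subset_refl] by simp
qed

lemma nonmember_cases:
  assumes "S \<subseteq> E" "S \<notin> F"
  obtains (bottom) "S \<in> diamond_bottoms F"
  | (middle) W X Z where "W \<in> F" "X \<in> F" "Z \<in> F" "W \<subseteq> S" "W \<subseteq> X" "S \<subseteq> Z" "X \<subseteq> Z"
      "\<not> S \<subseteq> X" "\<not> X \<subseteq> S"
  | (top) W X Y where "W \<in> F" "X \<in> F" "Y \<in> F" "W \<subseteq> X" "W \<subseteq> Y" "X \<subseteq> S" "Y \<subseteq> S"
      "\<not> X \<subseteq> Y" "\<not> Y \<subseteq> X"
proof -
  obtain W X Y Z where members: "W \<in> insert S F" "X \<in> insert S F" "Y \<in> insert S F" "Z \<in> insert S F"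
    and diamond: "W \<subseteq> X" "W \<subseteq> Y" "X \<subseteq> Z" "Y \<subseteq> Z" "\<not> X \<subseteq> Y" "\<not> Y \<subseteq> X"
    using saturated[OF assms] by (rule not_diamond_freeE)
  consider "W = S" | "X = S" | "Y = S" | "Z = S" | "W \<in> F" "X \<in> F" "Y \<in> F" "Z \<in> F"
    using members by blast
  then show thesis
  proof cases
    assume "W = S"
    then have "X \<in> F" "Y \<in> F" "Z \<in> F" using members diamond by auto
    then have "S \<in> diamond_bottoms F"
      using diamond \<open>W = S\<close> unfolding diamond_bottoms_def by blast
    then show thesis by (rule bottom)
  next
    assume "X = S"
    then have "W \<in> F" "Y \<in> F" "Z \<in> F" using members diamond by auto
    with diamond \<open>X = S\<close> show thesis by (intro middle[of W Y Z]) auto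
  next
    assume "Y = S"
    then have "W \<in> F" "X \<in> F" "Z \<in> F" using members diamond by auto
    with diamond \<open>Y = S\<close> show thesis by (intro middle[of W X Z]) auto
  next
    assume "Z = S"
    then have "W \<in> F" "X \<in> F" "Y \<in> F" using members diamond by auto
    with diamond \<open>Z = S\<close> show thesis by (intro top[of W X Y]) auto
  next
    assume "W \<in> F" "X \<in> F" "Y \<in> F" "Z \<in> F"
    from interval_chain[OF this diamond(1-4)] diamond(5,6) show thesis by blast
  qed
qed

lemma members_nonempty: "F \<noteq> {}"
proof
  assume "F = {}"
  with saturated[of "{}"] show False
    by (simp add: diamond_free_def diamond_bottoms_def)
qed

lemma ex_minimal_member_below_non_bottom:
  assumes "S \<subseteq> E" "S \<notin> diamond_bottoms F"
  shows "\<exists>W\<in>minimal_members F. W \<subseteq> S"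
proof -
  have "\<exists>V\<in>F. V \<subseteq> S"
  proof (cases "S \<in> F")
    case False
    with assms(1) show ?thesis by (cases rule: nonmember_cases) (use assms(2) in blast)+
  qed blast
  then show ?thesis using ex_minimal_member_below[OF finite_members] by (meson subset_trans)
qed

section \<open>Points of minimal members\<close>

lemma minimal_member_remove_bottom:
  assumes "W \<in> minimal_members F" "j \<in> W"
  shows "W - {j} \<in> diamond_bottoms F"
proof (rule ccontr)
  assume "W - {j} \<notin> diamond_bottoms F"
  moreover have "W - {j} \<subseteq> E"
    using assms(1) members_subset minimal_members_subset by blast
  ultimately obtain V where "V \<in> minimal_members F" "V \<subseteq> W - {j}"
    using ex_minimal_member_below_non_bottom by blast
  with assms show False unfolding minimal_members_def by blast
qed

lemma card_minimal_member_le: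
  assumes "W \<in> minimal_members F"
  shows "card W \<le> card F"
proof (rule card_le_if_inj_on_rel[where r = "\<lambda>j X. W - X = {j}"])
  fix j assume j: "j \<in> W"
  have "insert j (W - {j}) \<notin> diamond_bottoms F"
    using assms minimal_members_subset member_not_subset_diamond_bottom by blast
  from obtain_nonmaximal_member_avoiding[OF minimal_member_remove_bottom[OF assms j] this]
  obtain X where "X \<in> F - maximal_members F" "W - {j} \<subseteq> X" "j \<notin> X" .
  with j show "\<exists>X. X \<in> F \<and> W - X = {j}" by blast
qed (use finite_members in auto)

lemma ex_minimal_member_diff_bottom_eq_singleton:
  assumes "S \<in> diamond_bottoms F" "i \<in> E" "insert i S \<notin> diamond_bottoms F"
  shows "\<exists>W\<in>minimal_members F. W - S = {i}"
proof -
  have "insert i S \<subseteq> E" using assms(1,2) diamond_bottoms_subset by blast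
  then obtain W where W: "W \<in> minimal_members F" "W \<subseteq> insert i S"
    using ex_minimal_member_below_non_bottom assms(3) by blast
  have "\<not> W \<subseteq> S"
    using W(1) minimal_members_subset member_not_subset_diamond_bottom[OF _ assms(1)] by blast
  with W show ?thesis by blast
qed

lemma insert_maximal_bottom_not_bottom:
  "M \<in> maximal_members (diamond_bottoms F) \<Longrightarrow> i \<notin> M \<Longrightarrow> insert i M \<notin> diamond_bottoms F"
  unfolding maximal_members_def by blast

lemma ex_minimal_member_diff_maximal_bottom_eq_singleton:
  assumes "M \<in> maximal_members (diamond_bottoms F)" "i \<in> E - M"
  shows "\<exists>W\<in>minimal_members F. W - M = {i}"
  using assms insert_maximal_bottom_not_bottom maximal_members_subset
  by (intro ex_minimal_member_diff_bottom_eq_singleton) blast+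

lemma card_Diff_maximal_bottom_le:
  assumes "M \<in> maximal_members (diamond_bottoms F)"
  shows "card (E - M) \<le> card F"
proof (rule card_le_if_inj_on_rel[where r = "\<lambda>i W. W - M = {i}"])
  show "\<exists>W. W \<in> F \<and> W - M = {i}" if "i \<in> E - M" for i
    using ex_minimal_member_diff_maximal_bottom_eq_singleton[OF assms that] minimal_members_subset
    by blast
qed (use finite_members in auto)

lemma ex_large_nonmaximal_above_maximal_bottom:
  assumes "M \<in> maximal_members (diamond_bottoms F)" "i \<notin> M"
  shows "\<exists>X\<in>large_nonmaximal_members E F. M \<subseteq> X \<and> i \<notin> X"
proof -
  have "M \<in> diamond_bottoms F" using assms(1) maximal_members_subset by blast
  from obtain_nonmaximal_member_avoiding[OF this insert_maximal_bottom_not_bottom[OF assms]]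
  obtain X where X: "X \<in> F - maximal_members F" "M \<subseteq> X" "i \<notin> X" .
  have "card (E - X) \<le> card (E - M)" using X(2) finite_ground by (intro card_mono) auto
  also have "\<dots> \<le> card F" by (rule card_Diff_maximal_bottom_le[OF assms(1)])
  finally have "X \<in> large_nonmaximal_members E F"
    using X(1) by (simp add: large_nonmaximal_members_def)
  with X show ?thesis by blast
qed

lemma ex_minimal_diff_large_nonmaximal_eq_singleton:
  assumes "i \<in> \<Union> (minimal_members F)"
  shows "\<exists>W\<in>minimal_members F. \<exists>X\<in>large_nonmaximal_members E F. W - X = {i}"
proof -
  obtain W where W: "W \<in> minimal_members F" "i \<in> W" using assms by blast
  then have "W \<in> F" using minimal_members_subset by blast
  have "finite (diamond_bottoms F)"
    using diamond_bottoms_subset finite_ground by (simp add: finite_subset)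
  then obtain M where M: "M \<in> maximal_members (diamond_bottoms F)" "W - {i} \<subseteq> M"
    using ex_maximal_member_above minimal_member_remove_bottom[OF W] by blast
  have "\<not> W \<subseteq> M"
    using M(1) maximal_members_subset member_not_subset_diamond_bottom[OF \<open>W \<in> F\<close>] by blast
  then have "i \<notin> M" using M(2) by blast
  have "i \<in> E" using W(2) \<open>W \<in> F\<close> members_subset by blast
  with M(1) \<open>i \<notin> M\<close> obtain V where V: "V \<in> minimal_members F" "V - M = {i}"
    using ex_minimal_member_diff_maximal_bottom_eq_singleton by blast
  obtain X where X: "X \<in> large_nonmaximal_members E F" "M \<subseteq> X" "i \<notin> X"
    using ex_large_nonmaximal_above_maximal_bottom[OF M(1) \<open>i \<notin> M\<close>] by blast
  have "V - X = {i}" using V(2) X(2,3) by blast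
  with V(1) X(1) show ?thesis by blast
qed

lemma card_Union_minimal_members_le:
  "card (\<Union> (minimal_members F)) \<le>
     card (minimal_members F) * card (large_nonmaximal_members E F)"
  unfolding card_cartesian_product[symmetric]
proof (rule card_le_if_inj_on_rel[where r = "\<lambda>i p. fst p - snd p = {i}"])
  have "minimal_members F \<subseteq> F" "large_nonmaximal_members E F \<subseteq> F"
    by (auto simp: minimal_members_def large_nonmaximal_members_def)
  then show "finite (minimal_members F \<times> large_nonmaximal_members E F)"
    using finite_members finite_subset by blast
  show "\<exists>p. p \<in> minimal_members F \<times> large_nonmaximal_members E F \<and> fst p - snd p = {i}"
    if "i \<in> \<Union> (minimal_members F)" for i
    using ex_minimal_diff_large_nonmaximal_eq_singleton[OF that] by fastforce
  show "i = j" if "fst p - snd p = {i}" "fst p - snd p = {j}"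
    for i j and p :: "'a set \<times> 'a set"
    using that by simp
qed

section \<open>Points outside all minimal members\<close>

definition augmentable_members :: "'a \<Rightarrow> 'a set set" where
  "augmentable_members i = {P \<in> F. i \<notin> P \<and> (\<exists>Z\<in>F. insert i P \<subseteq> Z)}"

lemma ex_minimal_member_below_insert:
  assumes "i \<notin> \<Union> (minimal_members F)" "S \<in> F" "S \<subseteq> insert i P"
  shows "\<exists>V\<in>minimal_members F. V \<subseteq> S \<and> V \<subseteq> P"
proof -
  obtain V where V: "V \<in> minimal_members F" "V \<subseteq> S"
    using ex_minimal_member_below[OF finite_members assms(2)] by blast
  then have "i \<notin> V" using assms(1) by blast
  with V assms(3) show ?thesis by blast
qed

lemma minimal_member_augmentable:
  assumes "W \<in> minimal_members F" "i \<in> E - \<Union> (minimal_members F)"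
  shows "W \<in> augmentable_members i"
proof -
  have W: "W \<in> F" "i \<notin> W" using assms minimal_members_subset by auto
  have "\<exists>Z\<in>F. insert i W \<subseteq> Z"
  proof (cases "insert i W \<in> F")
    case False
    have "insert i W \<subseteq> E" using W(1) assms(2) members_subset by blast
    from this False show ?thesis
    proof (cases rule: nonmember_cases)
      case bottom
      then show ?thesis
        using member_not_subset_diamond_bottom[OF W(1)] by blast
    next
      case (top U X Y)
      have "U \<subseteq> insert i W" using top by blast
      then obtain V where V: "V \<in> minimal_members F" "V \<subseteq> U" "V \<subseteq> W"
        using ex_minimal_member_below_insert assms(2) top(1) by blast
      then have "V = W" using assms(1) by (auto simp: minimal_members_def)
      then have "W \<subseteq> X" "W \<subseteq> Y" using V(2) top by auto
      then have "X \<subseteq> Y \<or> Y \<subseteq> X" using \<open>X \<subseteq> insert i W\<close> \<open>Y \<subseteq> insert i W\<close> by blast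
      with top show ?thesis by simp
    qed blast
  qed blast
  with W show ?thesis by (simp add: augmentable_members_def)
qed

lemma subset_augmentable_if_subset_insert:
  assumes P: "P \<in> augmentable_members i" "insert i P \<notin> F"
    and V: "V \<in> F" "V \<subseteq> P" "V \<subseteq> S"
    and S: "S \<in> F" "S \<subseteq> insert i P"
  shows "S \<subseteq> P"
proof -
  obtain Z where Z: "P \<in> F" "Z \<in> F" "insert i P \<subseteq> Z"
    using P(1) by (auto simp: augmentable_members_def)
  have "S \<subseteq> P \<or> P \<subseteq> S"
    by (rule interval_chain[OF V(1) S(1) Z(1,2) V(3,2)]) (use S Z in auto)
  moreover have "S \<noteq> insert i P" using S(1) P(2) by blast
  ultimately show ?thesis using S(2) by blast
qed

lemma insert_maximal_augmentable_member:
  assumes P: "P \<in> maximal_members (augmentable_members i)"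
    and i: "i \<in> E - \<Union> (minimal_members F)"
  shows "insert i P \<in> F"
proof (rule ccontr)
  assume nonmember: "insert i P \<notin> F"
  have augmentable: "P \<in> augmentable_members i"
    using P maximal_members_subset by blast
  then have "P \<in> F" by (simp add: augmentable_members_def)
  have member_below: "\<exists>V\<in>F. V \<subseteq> U \<and> V \<subseteq> P" if "U \<in> F" "U \<subseteq> insert i P" for U
    using ex_minimal_member_below_insert[OF _ that] i minimal_members_subset by blast
  have "insert i P \<subseteq> E" using \<open>P \<in> F\<close> i members_subset by blast
  from this nonmember show False
  proof (cases rule: nonmember_cases)
    case bottom
    then show False
      using member_not_subset_diamond_bottom[OF \<open>P \<in> F\<close>] by blast
  next
    case (middle U X Z)
    obtain V where V: "V \<in> F" "V \<subseteq> U" "V \<subseteq> P"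
      using member_below[OF \<open>U \<in> F\<close> \<open>U \<subseteq> insert i P\<close>] by blast
    have "P \<subseteq> X \<or> X \<subseteq> P"
      by (rule interval_chain[OF V(1) \<open>P \<in> F\<close> \<open>X \<in> F\<close> \<open>Z \<in> F\<close>]) (use V middle in auto)
    then have "P \<subset> X" "i \<notin> X" using middle by auto
    have "insert i X \<subseteq> Z" using \<open>insert i P \<subseteq> Z\<close> \<open>X \<subseteq> Z\<close> by blast
    with \<open>X \<in> F\<close> \<open>Z \<in> F\<close> \<open>i \<notin> X\<close> have "X \<in> augmentable_members i"
      unfolding augmentable_members_def by blast
    with P \<open>P \<subset> X\<close> show False unfolding maximal_members_def by blast
  next
    case (top U X Y)
    then have "U \<subseteq> insert i P" by (meson subset_trans)
    then obtain V where V: "V \<in> F" "V \<subseteq> U" "V \<subseteq> P" using member_below[OF \<open>U \<in> F\<close>] by blast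
    then have "V \<subseteq> X" "V \<subseteq> Y" using top by auto
    then have "X \<subseteq> P" "Y \<subseteq> P"
      using subset_augmentable_if_subset_insert[OF augmentable nonmember V(1,3)] top by simp_all
    with \<open>V \<subseteq> X\<close> \<open>V \<subseteq> Y\<close> have "X \<subseteq> Y \<or> Y \<subseteq> X"
      using interval_chain[OF V(1) \<open>X \<in> F\<close> \<open>Y \<in> F\<close> \<open>P \<in> F\<close>] by simp
    with top show False by simp
  qed
qed

lemma ex_member_adding_point_above:
  assumes "W \<in> minimal_members F" "i \<in> E - \<Union> (minimal_members F)"
  shows "\<exists>Q\<in>F. i \<in> Q \<and> W \<subseteq> Q - {i} \<and> Q - {i} \<in> F"
proof -
  have "finite (augmentable_members i)"
    using finite_members by (simp add: augmentable_members_def)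
  then obtain P where P: "P \<in> maximal_members (augmentable_members i)" "W \<subseteq> P"
    using ex_maximal_member_above minimal_member_augmentable[OF assms] by blast
  have "P \<in> F" "i \<notin> P"
    using P(1) maximal_members_subset unfolding augmentable_members_def by blast+
  with P(2) insert_maximal_augmentable_member[OF P(1) assms(2)] show ?thesis
    by (intro bexI[of _ "insert i P"]) auto
qed

lemma card_outside_minimal_members_le: "card (E - \<Union> (minimal_members F)) \<le> card F"
proof -
  obtain W where W: "W \<in> minimal_members F"
    using members_nonempty ex_minimal_member_below[OF finite_members] by blast
  then have "W \<in> F" using minimal_members_subset by blast
  show ?thesis
  proof (rule card_le_if_inj_on_rel[where r = "\<lambda>i Q. i \<in> Q \<and> W \<subseteq> Q - {i} \<and> Q - {i} \<in> F"])
    show "\<exists>Q. Q \<in> F \<and> i \<in> Q \<and> W \<subseteq> Q - {i} \<and> Q - {i} \<in> F"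
      if "i \<in> E - \<Union> (minimal_members F)" for i
      using ex_member_adding_point_above[OF W that] by blast
    show "i = j" if "Q \<in> F" "i \<in> Q \<and> W \<subseteq> Q - {i} \<and> Q - {i} \<in> F"
      "j \<in> Q \<and> W \<subseteq> Q - {j} \<and> Q - {j} \<in> F" for i j Q
    proof -
      have "Q - {i} \<subseteq> Q - {j} \<or> Q - {j} \<subseteq> Q - {i}"
        by (rule interval_chain[OF \<open>W \<in> F\<close> _ _ \<open>Q \<in> F\<close>]) (use that in auto)
      with that show ?thesis by blast
    qed
  qed (rule finite_members)
qed

section \<open>Counting members\<close>

lemma card_ground_le_minimal_times_large:
  "card E \<le> card F + card (minimal_members F) * card (large_nonmaximal_members E F)"
proof -
  let ?U = "\<Union> (minimal_members F)"
  have "?U \<subseteq> E" using members_subset minimal_members_subset by blast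
  then have "card E = card ?U + card (E - ?U)"
    using card_Int_Diff[OF finite_ground, of ?U] by (simp add: Int_absorb1)
  then show ?thesis
    using card_outside_minimal_members_le card_Union_minimal_members_le by linarith
qed

lemma card_ground_le_maximal_times_small:
  "card E \<le> card F + card (maximal_members F) * card (small_nonminimal_members F)"
proof -
  have "maximal_members F \<subseteq> Pow E" "small_nonminimal_members F \<subseteq> Pow E"
    using members_subset by (auto simp: maximal_members_def small_nonminimal_members_def)
  then show ?thesis
    using diamond_saturated_family.card_ground_le_minimal_times_large[OF complement_saturated]
    by (simp add: members_subset minimal_members_complement large_nonmaximal_members_complement
        card_image_complement)
qed

lemma card_Diff_maximal_member_le:
  assumes "Z \<in> maximal_members F"
  shows "card (E - Z) \<le> card F"
proof -
  have "E - Z \<in> minimal_members ((-) E ` F)"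
    using assms by (simp add: minimal_members_complement[OF members_subset])
  from diamond_saturated_family.card_minimal_member_le[OF complement_saturated this]
  show ?thesis by (simp add: card_image_complement[OF members_subset])
qed

lemma card_small_members:
  "card {S \<in> F. card S \<le> card F} = card (minimal_members F) + card (small_nonminimal_members F)"
proof -
  let ?S = "{S \<in> F. card S \<le> card F}"
  have "?S \<inter> minimal_members F = minimal_members F"
    using card_minimal_member_le minimal_members_subset by blast
  moreover have "?S - minimal_members F = small_nonminimal_members F"
    by (auto simp: small_nonminimal_members_def)
  ultimately show ?thesis using card_Int_Diff[of ?S "minimal_members F"] finite_members by simp
qed

lemma card_large_members:
  "card {S \<in> F. card (E - S) \<le> card F} =
     card (maximal_members F) + card (large_nonmaximal_members E F)"
proof -
  let ?L = "{S \<in> F. card (E - S) \<le> card F}"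
  have "?L \<inter> maximal_members F = maximal_members F"
    using card_Diff_maximal_member_le maximal_members_subset by blast
  moreover have "?L - maximal_members F = large_nonmaximal_members E F"
    by (auto simp: large_nonmaximal_members_def)
  ultimately show ?thesis using card_Int_Diff[of ?L "maximal_members F"] finite_members by simp
qed

lemma card_small_add_card_large_le:
  assumes "2 * card F < card E"
  shows "card {S \<in> F. card S \<le> card F} + card {S \<in> F. card (E - S) \<le> card F} \<le> card F"
proof -
  have "card E \<le> card S + card (E - S)" if "S \<in> F" for S
  proof -
    have "finite S" using that members_subset finite_ground finite_subset by blast
    from diff_card_le_card_Diff[OF this, of E] show ?thesis by linarith
  qed
  then have "{S \<in> F. card S \<le> card F} \<inter> {S \<in> F. card (E - S) \<le> card F} = {}"
    using assms by fastforce
  then have "card {S \<in> F. card S \<le> card F} + card {S \<in> F. card (E - S) \<le> card F} =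
      card ({S \<in> F. card S \<le> card F} \<union> {S \<in> F. card (E - S) \<le> card F})"
    using finite_members by (simp add: card_Un_disjoint)
  also have "\<dots> \<le> card F" using finite_members by (intro card_mono) auto
  finally show ?thesis .
qed

end

section \<open>The lower bound\<close>

lemma four_mult_le_power2_sum: "4 * (x * y) \<le> (x + y)\<^sup>2" for x y :: nat
proof -
  have "4 * (real x * real y) \<le> (real x + real y)\<^sup>2"
    using sum_squares_bound[of "real x" "real y"] by (simp add: power2_sum)
  then have "real (4 * (x * y)) \<le> real ((x + y)\<^sup>2)" by simp
  then show ?thesis by (simp only: of_nat_le_iff)
qed

lemma (in diamond_saturated_family) card_ground_le_power2_card:
  "16 * card E \<le> (card F + 8)\<^sup>2"
proof (cases "2 * card F < card E")
  case True
  define a l where "a = card (minimal_members F)" and "l = card (large_nonmaximal_members E F)"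
  define b m where "b = card (maximal_members F)" and "m = card (small_nonminimal_members F)"
  have "(a + m) + (b + l) \<le> card F"
    using card_small_add_card_large_le[OF True]
    by (simp add: card_small_members card_large_members a_def l_def b_def m_def)
  then have "2 * (a + l) \<le> card F \<or> 2 * (b + m) \<le> card F" by arith
  then obtain p q where pq: "card E \<le> card F + p * q" "2 * (p + q) \<le> card F"
    using card_ground_le_minimal_times_large card_ground_le_maximal_times_small
    unfolding a_def l_def b_def m_def by blast
  have "16 * (p * q) \<le> 4 * (p + q)\<^sup>2" using four_mult_le_power2_sum[of p q] by simp
  also have "\<dots> = (2 * (p + q))\<^sup>2" by (simp only: power_mult_distrib) simp
  also have "\<dots> \<le> (card F)\<^sup>2" using pq(2) by (rule power_mono) simp
  finally have "16 * card E \<le> 16 * card F + (card F)\<^sup>2" using pq(1) by linarith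
  also have "\<dots> \<le> (card F + 8)\<^sup>2" by (simp add: power2_sum)
  finally show ?thesis .
next
  case False
  then have "16 * card E \<le> 4 * (card F * 8)" by simp
  also have "\<dots> \<le> (card F + 8)\<^sup>2" by (rule four_mult_le_power2_sum)
  finally show ?thesis .
qed

lemma diamond_saturated_imp_diamond_saturated_family:
  "diamond_saturated n F \<Longrightarrow> diamond_saturated_family {1..n} F"
  by unfold_locales
    (auto simp: diamond_saturated_def has_induced_diamond_iff_not_diamond_free)

lemma sat_star_diamond_attained:
  obtains F where "diamond_saturated n F" "card F = sat_star_diamond n"
proof -
  have "sat_star_diamond n \<in> {card F | F. diamond_saturated n F}"
    unfolding sat_star_diamond_def
    by (rule Min_in[OF finite_card_diamond_saturated card_diamond_saturated_nonempty])
  with that show thesis by auto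
qed

lemma sat_star_diamond_ge: "4 * sqrt (real n) - 8 \<le> real (sat_star_diamond n)"
proof -
  obtain F where F: "diamond_saturated n F" "card F = sat_star_diamond n"
    by (rule sat_star_diamond_attained)
  interpret diamond_saturated_family "{1..n}" F
    using F(1) by (rule diamond_saturated_imp_diamond_saturated_family)
  have "real (16 * n) \<le> real ((sat_star_diamond n + 8)\<^sup>2)"
    using card_ground_le_power2_card F(2) by (simp only: of_nat_le_iff) simp
  then have "(4 * sqrt (real n))\<^sup>2 \<le> (real (sat_star_diamond n) + 8)\<^sup>2"
    by (simp add: power_mult_distrib)
  then have "4 * sqrt (real n) \<le> real (sat_star_diamond n) + 8"
    by (rule power2_le_imp_le) simp
  then show ?thesis by simp
qed

theorem theorem2:
  fixes c :: real
  assumes "c < 4"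
  shows "\<exists>n0::nat. \<forall>n\<ge>n0. real (sat_star_diamond n) \<ge> c * sqrt (real n)"
proof -
  obtain n0 :: nat where n0_ge: "(8 / (4 - c))\<^sup>2 \<le> real n0"
    using real_arch_simple by blast
  have "c * sqrt (real n) \<le> real (sat_star_diamond n)" if "n \<ge> n0" for n
  proof -
    have "(8 / (4 - c))\<^sup>2 \<le> real n" using n0_ge that by simp
    then have "8 / (4 - c) \<le> sqrt (real n)" by (rule real_le_rsqrt)
    then have "8 \<le> (4 - c) * sqrt (real n)" using assms by (simp add: field_simps)
    then have "c * sqrt (real n) \<le> 4 * sqrt (real n) - 8" by (simp add: algebra_simps)
    also have "\<dots> \<le> real (sat_star_diamond n)" by (rule sat_star_diamond_ge)
    finally show ?thesis .
  qed
  then show ?thesis by blast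
qed

end
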